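(* For $A=|\psi\rangle\langle\psi|$ with $|\psi\rangle\in\mathbb C^{2^n}$ and $C=\operatorname{diag}(1,0,\dots,0)\in\mathrm{Mat}_{2^n}(\mathbb C)$, the minimal Euclidean distance $$\Delta:=\min_{K\in SU_{\rm loc}(2^n)}\ \|KAK^\dagger-C\|_2$$ is a measure of pure-state entanglement because it quantifies how far $A$ is from the equivalence class of pure product states. It relates to the maximum real part of the local numerical range $W_{\rm loc}(A)$ via $$\|C-KAK^\dagger\|_2^2=\|A\|_2^2+\|C\|_2^2-2\operatorname{Re}\operatorname{tr}\{C^\dagger KAK^\dagger\}=2-2\operatorname{Re}\operatorname{tr}\{C^\dagger KAK^\dagger\},$$ where $K\in SU_{\rm loc}(2^n)$ and the last equality holds if also $A$ is normalised to $\|A\|_2=1$.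
   Context: $\|\cdot\|_2$ is the Euclidean (Frobenius, Hilbert–Schmidt) norm. $SU_{\rm loc}(2^n)=SU(2)\otimes\cdots\otimes SU(2)$ ($n$ factors) is the group of local unitary operations, i.e. the set of all tensor products $K_1\otimes\cdots\otimes K_n$ with $K_j\in SU(2)$. The local numerical range (local field of values) of $A$ is $W_{\rm loc}(A)=\{\operatorname{tr}(C^\dagger KAK^\dagger) : K\in SU_{\rm loc}(2^n)\}$ with $C=\operatorname{diag}(1,0,\dots,0)$. An $n$-qubit pure state $A=|\psi\rangle\langle\psi|$ with $|\psi\rangle\in\mathbb C^{2^n}$ is called a product state if it can be written as $|\psi_1\rangle\langle\psi_1|\otimes\cdots\otimes|\psi_n\rangle\langle\psi_n|$ with $|\psi_j\rangle\in\mathbb C^2$, and entangled if it cannot. All pure product states form an equivalence class coinciding with the local unitary orbit $\{KAK^\dagger : K\in SU_{\rm loc}(2^n)\}$ of an arbitrary pure product state $A$; the matrix $C$ above is itself a pure product state. State vectors are by convention of unit norm. *)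

theory Defs
  imports "HOL-Analysis.Analysis" "HOL-Library.Numeral_Type"
begin

text \<open>
  The qubits are indexed by a finite type \<open>'n\<close>, so the number of qubits is \<open>n = CARD('n) \<ge> 1\<close>.
  The standard product basis of the \<open>n\<close>-qubit space is indexed by \<open>'n \<Rightarrow> 2\<close>, a type with \<open>2 ^ n\<close>
  elements: \<open>complex ^ ('n \<Rightarrow> 2)\<close> is the space of \<open>n\<close>-qubit vectors.
  As usual in HOL-Analysis, the rows and columns of a two-by-two matrix are numbered by
  \<open>1, 2 :: 2\<close>, so \<open>1\<close> is the first basis index of a single qubit and \<open>\<lambda>_. 1\<close> the first basis
  index of the \<open>n\<close>-qubit space.
  The type class norm on \<open>complex ^ 'a ^ 'b\<close> is the root of the sum of the squared moduli of
  all entries, i.e. the Euclidean (Frobenius) norm.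
\<close>

type_synonym 'n qvec = "complex ^ ('n \<Rightarrow> 2)"
type_synonym 'n qmat = "complex ^ ('n \<Rightarrow> 2) ^ ('n \<Rightarrow> 2)"

definition dagger :: "complex ^ 'a ^ 'b \<Rightarrow> complex ^ 'b ^ 'a" where
  "dagger M = (\<chi> i j. cnj (M $ j $ i))"

definition ketbra :: "complex ^ 'a \<Rightarrow> complex ^ 'a ^ 'a" where
  "ketbra v = (\<chi> i j. v $ i * cnj (v $ j))"

definition SU2 :: "(complex ^ 2 ^ 2) set" where
  "SU2 = {U. dagger U ** U = mat 1 \<and> U ** dagger U = mat 1 \<and> det U = 1}"

text \<open>
  The Kronecker product of the family \<open>K\<close>: its entry at a pair of multi-indices is the product
  of the corresponding entries of the factors.
\<close>

definition tensor :: "('n::finite \<Rightarrow> complex ^ 2 ^ 2) \<Rightarrow> 'n qmat" where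
  "tensor K = (\<chi> s t. \<Prod>j\<in>UNIV. K j $ s j $ t j)"

definition SU_loc :: "('n::finite) qmat set" where
  "SU_loc = {tensor K | K. \<forall>j. K j \<in> SU2}"

definition Cmat :: "('n::finite) qmat" where
  "Cmat = (\<chi> s t. if s = (\<lambda>_. 1) \<and> t = (\<lambda>_. 1) then 1 else 0)"

definition conj_by :: "('n::finite) qmat \<Rightarrow> 'n qmat \<Rightarrow> 'n qmat" where
  "conj_by K A = K ** A ** dagger K"

definition W_loc :: "('n::finite) qmat \<Rightarrow> complex set" where
  "W_loc A = {trace (dagger Cmat ** conj_by K A) | K. K \<in> SU_loc}"

definition local_orbit :: "('n::finite) qmat \<Rightarrow> 'n qmat set" where
  "local_orbit A = {conj_by K A | K. K \<in> SU_loc}"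

definition pure_states :: "('n::finite) qmat set" where
  "pure_states = {ketbra \<psi> | \<psi>. norm \<psi> = 1}"

definition product_states :: "('n::finite) qmat set" where
  "product_states = {tensor (\<lambda>j. ketbra (\<phi> j)) | \<phi>. \<forall>j. norm (\<phi> j) = 1}"

definition entangled :: "('n::finite) qmat \<Rightarrow> bool" where
  "entangled A \<longleftrightarrow> A \<in> pure_states \<and> A \<notin> product_states"

definition is_minimum :: "real \<Rightarrow> real set \<Rightarrow> bool" where
  "is_minimum m S \<longleftrightarrow> m \<in> S \<and> (\<forall>x\<in>S. m \<le> x)"

definition is_maximum :: "real \<Rightarrow> real set \<Rightarrow> bool" where
  "is_maximum m S \<longleftrightarrow> m \<in> S \<and> (\<forall>x\<in>S. x \<le> m)"

text \<open>
  The minimal distance is introduced as an infimum over a nonempty set that is bounded below;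
  that it is attained is a claim to be proved.
\<close>

definition Delta :: "('n::finite) qmat \<Rightarrow> real" where
  "Delta A = (INF K\<in>SU_loc. norm (conj_by K A - Cmat))"

end

theory Submission
  imports Defs
begin

text \<open>
  The real inner product of matrices is the real part of the Hilbert--Schmidt product, so the
  distance identity is the polarisation identity combined with unitary invariance of the norm.
  Each unit vector of a qubit is the first column of an element of \<open>SU(2)\<close>; hence the product
  states form the local unitary orbit of \<open>Cmat\<close>, and moving the unitary from one
  argument of the distance to the other identifies \<open>Delta A\<close> with the distance of \<open>A\<close> to that
  orbit. The local unitary group is compact, so all extrema are attained.
\<close>

section \<open>Adjoints, the Hilbert-Schmidt product and ketbras\<close>

lemma dagger_mult: "dagger (M ** N) = dagger N ** dagger M"
  by (simp add: dagger_def matrix_matrix_mult_def vec_eq_iff mult.commute)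

lemma dagger_dagger [simp]: "dagger (dagger M) = M"
  by (simp add: dagger_def vec_eq_iff)

lemma inner_matrix_trace:
  fixes M N :: "complex ^ 'a::finite ^ 'b::finite"
  shows "M \<bullet> N = Re (trace (dagger M ** N))"
proof -
  have "M \<bullet> N = (\<Sum>i\<in>UNIV. \<Sum>j\<in>UNIV. Re (cnj (M $ i $ j) * N $ i $ j))"
    by (simp add: inner_vec_def inner_complex_def)
  \<comment> \<open>With the column index outside, each inner sum is a diagonal entry of
    \<open>dagger M ** N\<close>.\<close>
  also have "\<dots> = (\<Sum>j\<in>UNIV. \<Sum>i\<in>UNIV. Re (cnj (M $ i $ j) * N $ i $ j))"
    by (rule sum.swap)
  also have "\<dots> = Re (trace (dagger M ** N))"
    by (simp add: trace_def dagger_def matrix_matrix_mult_def)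
  finally show ?thesis .
qed

lemma norm_ketbra: "norm (ketbra (v :: complex ^ 'a::finite)) = (norm v)\<^sup>2"
proof -
  have "inner (a * cnj b) (a * cnj b) = (a \<bullet> a) * (b \<bullet> b)" for a b :: complex
    by (simp add: inner_complex_def algebra_simps)
  then have "ketbra v \<bullet> ketbra v = (v \<bullet> v) * (v \<bullet> v)"
    by (simp add: inner_vec_def ketbra_def sum_product)
  then show ?thesis
    by (simp add: norm_eq_sqrt_inner)
qed

lemma ketbra_matrix_vector_mult: "ketbra (U *v v) = U ** ketbra v ** dagger U"
  by (simp add: ketbra_def dagger_def matrix_matrix_mult_def matrix_vector_mult_def vec_eq_iff
      sum_distrib_left sum_distrib_right mult_ac)

text \<open>Inside the trace the middle \<open>dagger U ** U\<close> cancels, and cyclicity brings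
  the two outer factors together so that they cancel as well.\<close>

lemma inner_unitary_conjugation:
  fixes U M N :: "complex ^ 'a::finite ^ 'a"
  assumes "dagger U ** U = mat 1"
  shows "(U ** M ** dagger U) \<bullet> (U ** N ** dagger U) = M \<bullet> N"
proof -
  have "dagger (U ** M ** dagger U) ** (U ** N ** dagger U)
      = U ** (dagger M ** (dagger U ** U) ** N ** dagger U)"
    by (simp add: dagger_mult matrix_mul_assoc)
  also have "trace \<dots> = trace ((dagger M ** (dagger U ** U) ** N ** dagger U) ** U)"
    by (rule trace_mul_sym)
  also have "\<dots> = trace (dagger M ** N)"
    by (simp add: assms flip: matrix_mul_assoc)
  finally show ?thesis
    by (simp add: inner_matrix_trace)
qed

section \<open>Kronecker products\<close>

lemma tensor_mult: "tensor K ** tensor L = tensor (\<lambda>j. K j ** L j)"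
proof -
  \<comment> \<open>Distributivity: expanding a product of sums over \<open>k\<close> means choosing
    one \<open>k\<close> per factor, and these choices are exactly the multi-indices
    \<open>u\<close>.\<close>
  have "(\<Sum>u\<in>UNIV. (\<Prod>j\<in>UNIV. K j $ s j $ u j) * (\<Prod>j\<in>UNIV. L j $ u j $ t j))
      = (\<Prod>j\<in>UNIV. \<Sum>k\<in>UNIV. K j $ s j $ k * L j $ k $ t j)" for s t
    using prod_sum_PiE[of UNIV "\<lambda>_. UNIV" "\<lambda>j k. K j $ s j $ k * L j $ k $ t j"]
    by (simp add: PiE_UNIV_domain prod.distrib)
  then show ?thesis
    by (simp add: tensor_def matrix_matrix_mult_def vec_eq_iff)
qed

lemma dagger_tensor: "dagger (tensor K) = tensor (\<lambda>j. dagger (K j))"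
  by (simp add: dagger_def tensor_def vec_eq_iff)

lemma tensor_one: "tensor (\<lambda>_. mat 1) = mat 1"
  by (auto simp: tensor_def mat_def vec_eq_iff fun_eq_iff intro!: prod.neutral)

lemma Cmat_eq_tensor: "Cmat = tensor (\<lambda>_. ketbra (axis 1 1))"
  by (auto simp: tensor_def Cmat_def ketbra_def axis_def vec_eq_iff fun_eq_iff)

section \<open>The local unitary group\<close>

lemma SU2_mult: "U \<in> SU2 \<Longrightarrow> V \<in> SU2 \<Longrightarrow> U ** V \<in> SU2"
  unfolding SU2_def
  by (simp add: dagger_mult det_mul)
    (metis matrix_mul_assoc matrix_mul_lid)

lemma SU2_dagger:
  assumes "U \<in> SU2"
  shows "dagger U \<in> SU2"
proof -
  have "det (dagger U) * det U = 1"
    using assms unfolding SU2_def by (metis (mono_tags, lifting) mem_Collect_eq det_mul det_I)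
  with assms show ?thesis
    by (simp add: SU2_def)
qed

lemma SU_loc_mult: "K \<in> SU_loc \<Longrightarrow> L \<in> SU_loc \<Longrightarrow> K ** L \<in> SU_loc"
  unfolding SU_loc_def by (auto simp: tensor_mult intro!: SU2_mult)

lemma SU_loc_dagger: "K \<in> SU_loc \<Longrightarrow> dagger K \<in> SU_loc"
  unfolding SU_loc_def by (auto simp: dagger_tensor intro!: SU2_dagger)

lemma SU_loc_unitary:
  assumes "K \<in> SU_loc"
  shows "dagger K ** K = mat 1" and "K ** dagger K = mat 1"
  using assms by (auto simp: SU_loc_def SU2_def dagger_tensor tensor_mult tensor_one)

lemma mat_one_in_SU_loc: "mat 1 \<in> SU_loc"
proof -
  have "dagger (mat 1) = (mat 1 :: complex ^ 2 ^ 2)"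
    by (simp add: dagger_def mat_def vec_eq_iff)
  then have "(mat 1 :: complex ^ 2 ^ 2) \<in> SU2"
    by (simp add: SU2_def)
  then show ?thesis
    unfolding SU_loc_def by (auto intro!: exI[of _ "\<lambda>_. mat 1"] simp: tensor_one)
qed

section \<open>The action by conjugation and its orbits\<close>

lemma conj_by_mult: "conj_by (K ** L) A = conj_by K (conj_by L A)"
  by (simp add: conj_by_def dagger_mult matrix_mul_assoc)

lemma conj_by_diff: "conj_by K (A - B) = conj_by K A - conj_by K B"
  by (simp add: conj_by_def matrix_matrix_mult_def vec_eq_iff left_diff_distrib
      right_diff_distrib sum_subtractf)

lemma conj_by_mat_one [simp]: "conj_by (mat 1) A = A"
proof -
  have "dagger (mat 1) = (mat 1 :: 'a qmat)"
    by (simp add: dagger_def mat_def vec_eq_iff)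
  then show ?thesis
    by (simp add: conj_by_def)
qed

lemma norm_conj_by: "K \<in> SU_loc \<Longrightarrow> norm (conj_by K A) = norm A"
  by (simp add: conj_by_def norm_eq_sqrt_inner inner_unitary_conjugation SU_loc_unitary)

text \<open>Conjugation by \<open>K\<close> is a linear isometry with inverse conjugation by
  \<open>dagger K\<close>, so it can be pulled out of the difference.\<close>

lemma norm_diff_conj_by:
  assumes "K \<in> SU_loc"
  shows "norm (A - conj_by K B) = norm (conj_by (dagger K) A - B)"
proof -
  have "A - conj_by K B = conj_by K (conj_by (dagger K) A - B)"
    by (simp add: conj_by_diff SU_loc_unitary assms flip: conj_by_mult)
  then show ?thesis
    using assms by (simp add: norm_conj_by)
qed

lemma local_orbit_conj_by:
  assumes "K \<in> SU_loc"
  shows "local_orbit (conj_by K A) = local_orbit A"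
proof (intro equalityI subsetI)
  fix B assume "B \<in> local_orbit (conj_by K A)"
  then show "B \<in> local_orbit A"
    using assms unfolding local_orbit_def by (auto simp flip: conj_by_mult intro: SU_loc_mult)
next
  fix B assume "B \<in> local_orbit A"
  then obtain L where L: "L \<in> SU_loc" "B = conj_by L A"
    unfolding local_orbit_def by blast
  \<comment> \<open>The witness first undoes \<open>K\<close> and then applies
    \<open>L\<close>.\<close>
  have "conj_by (L ** dagger K) (conj_by K A) = B"
    using L assms by (simp add: SU_loc_unitary conj_by_mult)
      (simp add: SU_loc_unitary flip: conj_by_mult)
  then show "B \<in> local_orbit (conj_by K A)"
    using L assms unfolding local_orbit_def by (blast intro: SU_loc_mult SU_loc_dagger)
qed

section \<open>Product states as a single orbit\<close>

lemma norm_unitary_mult_vec: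
  fixes U :: "complex ^ 'a::finite ^ 'a"
  assumes "dagger U ** U = mat 1"
  shows "norm (U *v v) = norm v"
proof -
  \<comment> \<open>By \<open>norm_ketbra\<close> these are the squared vector norms, so invariance
    passes from matrices to vectors.\<close>
  have "norm (ketbra (U *v v)) = norm (ketbra v)"
    by (simp add: ketbra_matrix_vector_mult norm_eq_sqrt_inner inner_unitary_conjugation assms)
  then show ?thesis
    by (simp add: norm_ketbra)
qed

lemma SU2_first_column:
  fixes v :: "complex ^ 2"
  assumes "norm v = 1"
  obtains U where "U \<in> SU2" "U *v axis 1 1 = v"
proof
  \<comment> \<open>The second column is the unit vector orthogonal to \<open>v\<close> whose phase
    makes the determinant equal to the squared norm of \<open>v\<close>.\<close>
  define U :: "complex ^ 2 ^ 2" where "U = vector [vector [v $ 1, - cnj (v $ 2)], vector [v $ 2, cnj (v $ 1)]]"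
  have "(cmod (v $ 1))\<^sup>2 + (cmod (v $ 2))\<^sup>2 = 1"
    using assms by (simp add: norm_vec_def L2_set_def sum_2)
  then have *: "v $ 1 * cnj (v $ 1) + v $ 2 * cnj (v $ 2) = 1"
    by (metis complex_norm_square of_real_1 of_real_add)
  then show "U \<in> SU2"
    by (simp add: SU2_def U_def dagger_def matrix_matrix_mult_def vec_eq_iff forall_2 sum_2
        mat_def det_2 algebra_simps)
  show "U *v axis 1 1 = v"
    by (simp add: U_def matrix_vector_mult_def vec_eq_iff forall_2 sum_2 axis_def)
qed

text \<open>A local unitary acts on each tensor factor separately, and \<open>SU2\<close> carries
  the first basis vector to exactly the unit vectors of a qubit.\<close>

lemma product_states_eq_local_orbit_Cmat:
  "(product_states :: 'n::finite qmat set) = local_orbit Cmat"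
proof (intro equalityI subsetI)
  fix P :: "'n qmat" assume "P \<in> product_states"
  then obtain \<phi> where \<phi>: "P = tensor (\<lambda>j. ketbra (\<phi> j))" "\<And>j. norm (\<phi> j) = 1"
    unfolding product_states_def by blast
  have "\<exists>U. U \<in> SU2 \<and> U *v axis 1 1 = \<phi> j" for j
    using SU2_first_column[OF \<phi>(2)] by metis
  then obtain K where K: "\<And>j. K j \<in> SU2" "\<And>j. K j *v axis 1 1 = \<phi> j"
    by metis
  have "P = conj_by (tensor K) Cmat"
    by (simp add: \<phi>(1) Cmat_eq_tensor conj_by_def dagger_tensor tensor_mult K(2)
        flip: ketbra_matrix_vector_mult)
  then show "P \<in> local_orbit Cmat"
    using K(1) unfolding local_orbit_def SU_loc_def by blast
next
  fix P :: "'n qmat" assume "P \<in> local_orbit Cmat"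
  then obtain K where K: "\<And>j. K j \<in> SU2" "P = conj_by (tensor K) Cmat"
    unfolding local_orbit_def SU_loc_def by blast
  have "P = tensor (\<lambda>j. ketbra (K j *v axis 1 1))"
    by (simp add: K(2) Cmat_eq_tensor conj_by_def dagger_tensor tensor_mult
        ketbra_matrix_vector_mult)
  moreover have "norm (K j *v axis 1 1) = 1" for j
    using K(1)[of j] by (simp add: norm_unitary_mult_vec SU2_def)
  ultimately show "P \<in> product_states"
    unfolding product_states_def by auto
qed

section \<open>Compactness of the local unitary group\<close>

lemma compact_SU2: "compact SU2"
proof (unfold compact_eq_bounded_closed, intro conjI)
  \<comment> \<open>The squared norm is the trace of \<open>dagger U ** U\<close>, hence of the
    two-by-two identity.\<close>
  have "norm U = sqrt 2" if "U \<in> SU2" for U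
    using that by (simp add: norm_eq_sqrt_inner inner_matrix_trace SU2_def trace_def mat_def)
  then show "bounded SU2"
    unfolding bounded_iff by (metis order_refl)
  show "closed SU2"
    unfolding SU2_def dagger_def matrix_matrix_mult_def det_2
    by (intro closed_Collect_conj closed_Collect_eq continuous_intros)
qed

text \<open>The group is a continuous image, under \<open>tensor\<close>, of a finite power of
  \<open>SU2\<close>. Families of factors are encoded as vectors over \<open>'n\<close>, a Euclidean
  space in which closed and bounded sets are compact.\<close>

lemma compact_SU_loc: "compact (SU_loc :: 'n::finite qmat set)"
proof -
  let ?S = "{K :: (complex ^ 2 ^ 2) ^ 'n. \<forall>j. K $ j \<in> SU2}"
  have "bounded ?S"
  proof -
    obtain B where B: "\<And>U. U \<in> SU2 \<Longrightarrow> norm U \<le> B"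
      using compact_imp_bounded[OF compact_SU2] unfolding bounded_iff by blast
    have "norm K \<le> (\<Sum>j\<in>(UNIV::'n set). B)" if "K \<in> ?S" for K
    proof -
      have "norm K \<le> (\<Sum>j\<in>UNIV. norm (K $ j))"
        unfolding norm_vec_def by (rule L2_set_le_sum) simp
      also have "\<dots> \<le> (\<Sum>j\<in>(UNIV::'n set). B)"
        using that B by (intro sum_mono) auto
      finally show ?thesis .
    qed
    then show ?thesis
      unfolding bounded_iff by blast
  qed
  moreover have "closed ?S"
  proof -
    have "closed ((\<lambda>K :: (complex ^ 2 ^ 2) ^ 'n. K $ j) -` SU2)" for j
      by (intro continuous_closed_vimage compact_imp_closed compact_SU2 continuous_intros)
    then have "closed (\<Inter>j. (\<lambda>K :: (complex ^ 2 ^ 2) ^ 'n. K $ j) -` SU2)"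
      by (intro closed_INT) auto
    moreover have "?S = (\<Inter>j. (\<lambda>K. K $ j) -` SU2)"
      by auto
    ultimately show ?thesis
      by simp
  qed
  ultimately have "compact ?S"
    by (simp add: compact_eq_bounded_closed)
  moreover have "continuous_on ?S (\<lambda>K. tensor (($) K))"
    unfolding tensor_def by (intro continuous_intros)
  ultimately have "compact ((\<lambda>K. tensor (($) K)) ` ?S)"
    by (rule compact_continuous_image[rotated])
  moreover have "SU_loc = (\<lambda>K. tensor (($) K)) ` ?S"
  proof (intro equalityI subsetI)
    fix M :: "'n qmat" assume "M \<in> SU_loc"
    then obtain K where K: "M = tensor K" "\<And>j. K j \<in> SU2"
      unfolding SU_loc_def by blast
    have "M = tensor (($) (vec_lambda K))" "vec_lambda K \<in> ?S"
      using K by (simp_all add: vec_lambda_inverse)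
    then show "M \<in> (\<lambda>K. tensor (($) K)) ` ?S"
      by blast
  qed (auto simp: SU_loc_def)
  ultimately show ?thesis
    by simp
qed

section \<open>The minimal distance and when it vanishes\<close>

lemma Delta_is_minimum:
  "is_minimum (Delta A) {norm (conj_by K A - Cmat) | K. K \<in> SU_loc}"
proof -
  have "continuous_on SU_loc (\<lambda>K. norm (conj_by K A - Cmat))"
    unfolding conj_by_def dagger_def matrix_matrix_mult_def
    by (intro continuous_intros)
  \<comment> \<open>A continuous function attains its infimum on a nonempty compact set; the
    identity shows that the group is nonempty.\<close>
  then obtain K where K: "K \<in> SU_loc"
    "\<And>L. L \<in> SU_loc \<Longrightarrow> norm (conj_by K A - Cmat) \<le> norm (conj_by L A - Cmat)"
    using continuous_attains_inf[OF compact_SU_loc] mat_one_in_SU_loc by (metis empty_iff)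
  have "Delta A = norm (conj_by K A - Cmat)"
    unfolding Delta_def by (rule cInf_eq_minimum) (use K in auto)
  then show ?thesis
    using K unfolding is_minimum_def by auto
qed

text \<open>Product states are the conjugates of \<open>Cmat\<close>; moving \<open>K\<close> to the
  other argument replaces it by \<open>dagger K\<close>, which again ranges over the group.\<close>

lemma distances_to_product_states:
  "{norm (A - P) | P. P \<in> product_states} = {norm (conj_by K A - Cmat) | K. K \<in> SU_loc}"
proof (intro equalityI subsetI)
  fix x assume "x \<in> {norm (A - P) | P. P \<in> product_states}"
  then obtain K where "K \<in> SU_loc" "x = norm (A - conj_by K Cmat)"
    by (auto simp: product_states_eq_local_orbit_Cmat local_orbit_def)
  then show "x \<in> {norm (conj_by K A - Cmat) | K. K \<in> SU_loc}"
    using norm_diff_conj_by SU_loc_dagger by blast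
next
  fix x assume "x \<in> {norm (conj_by K A - Cmat) | K. K \<in> SU_loc}"
  then obtain K where K: "K \<in> SU_loc" "x = norm (conj_by K A - Cmat)"
    by blast
  then have "x = norm (A - conj_by (dagger K) Cmat)"
    by (simp add: norm_diff_conj_by SU_loc_dagger)
  then show "x \<in> {norm (A - P) | P. P \<in> product_states}"
    using K SU_loc_dagger by (auto simp: product_states_eq_local_orbit_Cmat local_orbit_def)
qed

lemma Delta_is_minimum_product_states:
  "is_minimum (Delta A) {norm (A - P) | P. P \<in> product_states}"
  unfolding distances_to_product_states by (rule Delta_is_minimum)

lemma Cmat_in_product_states: "Cmat \<in> product_states"
  unfolding product_states_def Cmat_eq_tensor by (auto intro!: exI[of _ "\<lambda>_. axis 1 1"])

lemma product_states_eq_local_orbit: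
  assumes "P \<in> product_states"
  shows "product_states = local_orbit P"
proof -
  from assms obtain K where "K \<in> SU_loc" "P = conj_by K Cmat"
    unfolding product_states_eq_local_orbit_Cmat local_orbit_def by blast
  then show ?thesis
    by (simp add: local_orbit_conj_by product_states_eq_local_orbit_Cmat)
qed

lemma Delta_nonneg: "Delta A \<ge> 0"
  using Delta_is_minimum[of A] by (auto simp: is_minimum_def)

text \<open>Since the minimum is attained, distance zero means that some product state equals
  \<open>A\<close>.\<close>

lemma Delta_eq_0_iff: "Delta A = 0 \<longleftrightarrow> A \<in> product_states"
proof
  assume "Delta A = 0"
  then show "A \<in> product_states"
    using Delta_is_minimum_product_states[of A] by (auto simp: is_minimum_def)
next
  assume "A \<in> product_states"
  then have "Delta A \<le> norm (A - A)"
    using Delta_is_minimum_product_states[of A] unfolding is_minimum_def by blast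
  then show "Delta A = 0"
    using Delta_nonneg[of A] by simp
qed

section \<open>The distance identity and the local numerical range\<close>

lemma norm_Cmat: "norm (Cmat :: 'n::finite qmat) = 1"
proof -
  \<comment> \<open>Seen on the whole space rather than factorwise, \<open>Cmat\<close> is the
    projector onto one standard basis vector.\<close>
  have "Cmat = (ketbra (axis (\<lambda>_. 1) 1) :: 'n qmat)"
    by (auto simp: Cmat_def ketbra_def axis_def vec_eq_iff)
  then have "norm (Cmat :: 'n qmat) = (norm (axis (\<lambda>_ :: 'n. 1 :: 2) (1 :: complex)))\<^sup>2"
    by (metis norm_ketbra)
  then show ?thesis
    by simp
qed

lemma dist_Cmat_conj_by_squared:
  assumes "K \<in> SU_loc"
  shows "(norm (Cmat - conj_by K A))\<^sup>2 =
    (norm A)\<^sup>2 + (norm (Cmat :: 'n::finite qmat))\<^sup>2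
      - 2 * Re (trace (dagger Cmat ** conj_by K (A :: 'n qmat)))"
  using dot_norm_neg[of Cmat "conj_by K A"] norm_conj_by[OF assms, of A]
  by (simp add: inner_matrix_trace)

lemma maximum_Re_W_loc:
  "is_maximum (((norm A)\<^sup>2 + (norm (Cmat :: 'n::finite qmat))\<^sup>2 - (Delta A)\<^sup>2) / 2)
    (Re ` W_loc (A :: 'n qmat))"
proof -
  have tr: "Re (trace (dagger Cmat ** conj_by K A)) =
      ((norm A)\<^sup>2 + (norm (Cmat :: 'n qmat))\<^sup>2 - (norm (conj_by K A - Cmat))\<^sup>2) / 2"
    if "K \<in> SU_loc" for K
    using dist_Cmat_conj_by_squared[OF that, of A] by (simp add: norm_minus_commute)
  \<comment> \<open>The map applied to the distances is decreasing for \<open>d \<ge> 0\<close>, so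
    it sends the least distance to the greatest real part.\<close>
  have W: "Re ` W_loc A =
      (\<lambda>d. ((norm A)\<^sup>2 + (norm (Cmat :: 'n qmat))\<^sup>2 - d\<^sup>2) / 2) `
        {norm (conj_by K A - Cmat) | K. K \<in> SU_loc}"
    unfolding W_loc_def by (force simp: tr image_iff)
  show ?thesis
    using Delta_is_minimum[of A] Delta_nonneg[of A] unfolding W is_maximum_def is_minimum_def
    by (auto intro: power_mono)
qed

theorem corollary2p3:
  fixes \<psi> :: "('n::finite) qvec" and A :: "'n qmat"
  assumes A: "A = ketbra \<psi>"
  shows
    "is_minimum (Delta A) {norm (conj_by K A - Cmat) | K. K \<in> SU_loc}
     \<and> (Cmat :: 'n qmat) \<in> product_states
     \<and> (\<forall>P \<in> (product_states :: 'n qmat set). product_states = local_orbit P)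
     \<and> is_minimum (Delta A) {norm (A - P) | P. P \<in> product_states}
     \<and> (Delta A = 0 \<longleftrightarrow> A \<in> product_states)
     \<and> (norm A = 1 \<longrightarrow> (Delta A > 0 \<longleftrightarrow> entangled A))
     \<and> (\<forall>K \<in> SU_loc.
          (norm (Cmat - conj_by K A))\<^sup>2 =
            (norm A)\<^sup>2 + (norm (Cmat :: 'n qmat))\<^sup>2
              - 2 * Re (trace (dagger Cmat ** conj_by K A))
          \<and> (norm A = 1 \<longrightarrow>
               (norm A)\<^sup>2 + (norm (Cmat :: 'n qmat))\<^sup>2
                 - 2 * Re (trace (dagger Cmat ** conj_by K A)) =
               2 - 2 * Re (trace (dagger Cmat ** conj_by K A))))
     \<and> (\<exists>w. is_maximum w (Re ` W_loc A)
          \<and> (Delta A)\<^sup>2 = (norm A)\<^sup>2 + (norm (Cmat :: 'n qmat))\<^sup>2 - 2 * w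
          \<and> (norm A = 1 \<longrightarrow> (Delta A)\<^sup>2 = 2 - 2 * w))"
proof (intro conjI ballI impI exI)
  \<comment> \<open>This fixes the existential witness: the distance identity solved for the real
    part at distance \<open>Delta A\<close>. The equations for \<open>Delta A\<close> are then
    algebra.\<close>
  show "is_maximum (((norm A)\<^sup>2 + (norm (Cmat :: 'n qmat))\<^sup>2 - (Delta A)\<^sup>2) / 2) (Re ` W_loc A)"
    by (rule maximum_Re_W_loc)
  show "Delta A > 0 \<longleftrightarrow> entangled A" if "norm A = 1"
  proof -
    \<comment> \<open>The norm of \<open>A\<close> is the square of that of \<open>\<psi>\<close>,
      and nonnegativity rules out the root -1.\<close>
    have "norm \<psi> = 1"
      using that power2_eq_1_iff[of "norm \<psi>"] norm_ge_zero[of \<psi>] unfolding A norm_ketbra by linarith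
    then have "A \<in> pure_states"
      using A unfolding pure_states_def by blast
    then show ?thesis
      using Delta_eq_0_iff[of A] Delta_nonneg[of A] unfolding entangled_def by linarith
  qed
qed (simp_all add: Delta_is_minimum Delta_is_minimum_product_states Cmat_in_product_states
    product_states_eq_local_orbit[symmetric] Delta_eq_0_iff dist_Cmat_conj_by_squared[unfolded norm_Cmat] norm_Cmat field_simps)

end
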